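(* Let $n_1,n_2\ge 0$ be integers, let $\mathcal X=\{x_j\}_{j=1}^m\subset\mathbb C$ be a set of $m\ge N=n_1+n_2+2$ distinct points, and let $f:\mathcal X\to\mathbb C$ with $f\notin\mathscr R_{(n_1,n_2)}$ (i.e. $f$ does not agree on $\mathcal X$ with any element of $\mathscr R_{(n_1,n_2)}$). Let $\hat\xi=\hat p/\hat q\in\mathscr R_{(n_1,n_2)}$ be irreducible with $\mathcal E(\hat\xi)=\{z_j\}_{j=1}^d$ consisting of exactly $d=n_1+n_2-\upsilon(\hat p,\hat q)+2$ points. Then $\hat\xi$ is a global minimax approximant of $f$ on $\mathcal X$, i.e. $\|f-\hat\xi\|_{\infty,\mathcal X}=\inf_{\xi\in\mathscr R_{(n_1,n_2)}}\|f-\xi\|_{\infty,\mathcal X}$, if and only if there exist positive real numbers $\omega_1,\dots,\omega_d$ with $\sum_{j=1}^d\omega_j=1$ such that the Hermitian matrix $\sum_{j=1}^d\omega_jH(z_j)\in\mathbb C^{N\times N}$ is positive semi-definite, where $H(x)$ is defined in the context.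
   Context: $\mathbb P_k$ is the space of complex polynomials of degree at most $k$. $\mathscr R_{(n_1,n_2)}=\{p/q: p\in\mathbb P_{n_1},\ 0\not\equiv q\in\mathbb P_{n_2}\}$; a rational function is identified with its irreducible representation, and its error on $\mathcal X$ is infinite if it has a pole in $\mathcal X$. $\|f-\xi\|_{\infty,\mathcal X}=\max_{x\in\mathcal X}|f(x)-\xi(x)|$. It is understood that $\hat\xi$ has finite error on $\mathcal X$, i.e. $\hat q$ has no zeros in $\mathcal X$. The defect of an irreducible $p/q\in\mathscr R_{(n_1,n_2)}$ is $\upsilon(p,q)=\min(n_1-\deg p,\ n_2-\deg q)$, with $\deg 0=-\infty$. Put $\hat e(x)=f(x)-\hat\xi(x)$ and $\mathcal E(\hat\xi)=\{x\in\mathcal X: |\hat e(x)|=\|\hat e\|_{\infty,\mathcal X}\}$. Fix bases $\psi_0,\dots,\psi_{n_1}$ of $\mathbb P_{n_1}$ and $\phi_0,\dots,\phi_{n_2}$ of $\mathbb P_{n_2}$ (e.g. monomials; definiteness below does not depend on the choice). Define $$H(x)=\begin{bmatrix}H_1(x)&H_3(x)\\ H_3(x)^{\mathrm H}&H_2(x)\end{bmatrix}\in\mathbb C^{N\times N},$$ where $^{\mathrm H}$ is conjugate transpose and $[H_1(x)]_{\ell,k}=\overline{\psi_{\ell-1}(x)}\psi_{k-1}(x)$ for $1\le\ell,k\le n_1+1$; $[H_2(x)]_{\ell,k}=\left(|f(x)|^2-\|\hat e\|_{\infty,\mathcal X}^2\right)\overline{\phi_{\ell-1}(x)}\phi_{k-1}(x)$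 for $1\le\ell,k\le n_2+1$; $[H_3(x)]_{\ell,k}=-f(x)\overline{\psi_{\ell-1}(x)}\phi_{k-1}(x)$ for $1\le\ell\le n_1+1$, $1\le k\le n_2+1$. Equivalently, for $s=\sum_i \mathbf s_i\psi_i$ and $t=\sum_i\mathbf t_i\phi_i$, the quadratic form of $H(x)$ at $(\mathbf s,\mathbf t)$ equals $|f(x)t(x)-s(x)|^2-|t(x)|^2\|\hat e\|_{\infty,\mathcal X}^2$. *)

theory Defs
  imports
    "HOL-Analysis.Analysis"
    "HOL-Computational_Algebra.Computational_Algebra"
    "HOL-Computational_Algebra.Field_as_Ring"
    "Jordan_Normal_Form.Schur_Decomposition"
begin

section \<open>Polynomial spaces and rational functions\<close>

definition poly_space :: "nat \<Rightarrow> complex poly set" where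
  "poly_space k = {p. degree p \<le> k}"

definition poly_space_basis :: "nat \<Rightarrow> (nat \<Rightarrow> complex poly) \<Rightarrow> bool" where
  "poly_space_basis k \<psi> \<longleftrightarrow>
     inj_on \<psi> {0..k} \<and>
     \<not> Modules.module.dependent Polynomial.smult (\<psi> ` {0..k}) \<and>
     Modules.module.span Polynomial.smult (\<psi> ` {0..k}) = poly_space k"

definition rat_space :: "nat \<Rightarrow> nat \<Rightarrow> complex poly fract set" where
  "rat_space n1 n2 =
     {Fract p q | p q. p \<in> poly_space n1 \<and> q \<in> poly_space n2 \<and> q \<noteq> 0}"

text \<open>
  \<^const>\<open>quot_of_fract\<close> yields the coprime pair with monic denominator, i.e. the irreducible
  representation of a rational function. Values and poles always refer to this representation, so
  a removable singularity of some other representation is not a pole.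
\<close>

definition rat_eval :: "complex poly fract \<Rightarrow> complex \<Rightarrow> complex" where
  "rat_eval \<xi> x = poly (fst (quot_of_fract \<xi>)) x / poly (snd (quot_of_fract \<xi>)) x"

definition is_pole_of :: "complex poly fract \<Rightarrow> complex \<Rightarrow> bool" where
  "is_pole_of \<xi> x \<longleftrightarrow> poly (snd (quot_of_fract \<xi>)) x = 0"

definition agrees_on :: "complex set \<Rightarrow> (complex \<Rightarrow> complex) \<Rightarrow> complex poly fract \<Rightarrow> bool" where
  "agrees_on X f \<xi> \<longleftrightarrow> (\<forall>x\<in>X. \<not> is_pole_of \<xi> x \<and> f x = rat_eval \<xi> x)"

text \<open>
  Since \<open>deg 0 = -\<infinity>\<close>, the first argument of the minimum drops out for \<open>p = 0\<close>.
\<close>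

definition defect :: "nat \<Rightarrow> nat \<Rightarrow> complex poly \<Rightarrow> complex poly \<Rightarrow> int" where
  "defect n1 n2 p q =
     (if p = 0 then int n2 - int (degree q)
      else min (int n1 - int (degree p)) (int n2 - int (degree q)))"

section \<open>Minimax approximation on a finite set\<close>

definition max_norm :: "complex set \<Rightarrow> (complex \<Rightarrow> complex) \<Rightarrow> real" where
  "max_norm X g = Max ((\<lambda>x. cmod (g x)) ` X)"

definition residual :: "(complex \<Rightarrow> complex) \<Rightarrow> complex poly fract \<Rightarrow> complex \<Rightarrow> complex" where
  "residual f \<xi> x = f x - rat_eval \<xi> x"

definition approx_error :: "complex set \<Rightarrow> (complex \<Rightarrow> complex) \<Rightarrow> complex poly fract \<Rightarrow> ereal" where
  "approx_error X f \<xi> =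
     (if \<exists>x\<in>X. is_pole_of \<xi> x then \<infinity> else ereal (max_norm X (residual f \<xi>)))"

definition global_minimax ::
  "nat \<Rightarrow> nat \<Rightarrow> complex set \<Rightarrow> (complex \<Rightarrow> complex) \<Rightarrow> complex poly fract \<Rightarrow> bool" where
  "global_minimax n1 n2 X f \<xi> \<longleftrightarrow>
     approx_error X f \<xi> = (INF \<eta>\<in>rat_space n1 n2. approx_error X f \<eta>)"

definition extreme_points ::
  "complex set \<Rightarrow> (complex \<Rightarrow> complex) \<Rightarrow> complex poly fract \<Rightarrow> complex set" where
  "extreme_points X f \<xi> = {x \<in> X. cmod (residual f \<xi> x) = max_norm X (residual f \<xi>)}"

section \<open>The matrix \<open>H(x)\<close>\<close>

text \<open>Indices start at 0; the real parameter \<open>r\<close> stands for the maximal error of the approximant.\<close>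

definition H1_mat :: "nat \<Rightarrow> (nat \<Rightarrow> complex poly) \<Rightarrow> complex \<Rightarrow> complex mat" where
  "H1_mat n1 \<psi> x = mat (n1 + 1) (n1 + 1) (\<lambda>(l, k). cnj (poly (\<psi> l) x) * poly (\<psi> k) x)"

definition H2_mat ::
  "nat \<Rightarrow> (nat \<Rightarrow> complex poly) \<Rightarrow> (complex \<Rightarrow> complex) \<Rightarrow> real \<Rightarrow> complex \<Rightarrow> complex mat" where
  "H2_mat n2 \<phi> f r x = mat (n2 + 1) (n2 + 1)
     (\<lambda>(l, k). complex_of_real ((cmod (f x))\<^sup>2 - r\<^sup>2) * cnj (poly (\<phi> l) x) * poly (\<phi> k) x)"

definition H3_mat ::
  "nat \<Rightarrow> nat \<Rightarrow> (nat \<Rightarrow> complex poly) \<Rightarrow> (nat \<Rightarrow> complex poly) \<Rightarrow>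
   (complex \<Rightarrow> complex) \<Rightarrow> complex \<Rightarrow> complex mat" where
  "H3_mat n1 n2 \<psi> \<phi> f x = mat (n1 + 1) (n2 + 1)
     (\<lambda>(l, k). - f x * cnj (poly (\<psi> l) x) * poly (\<phi> k) x)"

definition H_mat ::
  "nat \<Rightarrow> nat \<Rightarrow> (nat \<Rightarrow> complex poly) \<Rightarrow> (nat \<Rightarrow> complex poly) \<Rightarrow>
   (complex \<Rightarrow> complex) \<Rightarrow> real \<Rightarrow> complex \<Rightarrow> complex mat" where
  "H_mat n1 n2 \<psi> \<phi> f r x =
     four_block_mat (H1_mat n1 \<psi> x) (H3_mat n1 n2 \<psi> \<phi> f x)
                    (mat_adjoint (H3_mat n1 n2 \<psi> \<phi> f x)) (H2_mat n2 \<phi> f r x)"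

definition weighted_mat_sum ::
  "nat \<Rightarrow> nat set \<Rightarrow> (nat \<Rightarrow> real) \<Rightarrow> (nat \<Rightarrow> complex mat) \<Rightarrow> complex mat" where
  "weighted_mat_sum N J \<omega> A =
     finsum (module_mat TYPE(complex) N N) (\<lambda>j. complex_of_real (\<omega> j) \<cdot>\<^sub>m A j) J"

text \<open>
  The number \<open>v\<^sup>H A v\<close> is real for Hermitian \<open>A\<close>; \<open>w \<bullet>c v\<close> conjugates its second argument.
\<close>

definition hermitian_psd :: "nat \<Rightarrow> complex mat \<Rightarrow> bool" where
  "hermitian_psd N A \<longleftrightarrow>
     A \<in> carrier_mat N N \<and> mat_adjoint A = A \<and>
     (\<forall>v\<in>carrier_vec N. 0 \<le> Re ((A *\<^sub>v v) \<bullet>c v))"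

end

theory Submission
  imports Defs
begin

text \<open>
  Write \<open>E\<close> for the set of extreme points, \<open>r\<close> for the error of \<open>p / q\<close>, \<open>e = f - p / q\<close> and
  \<open>w = p t - q s\<close>. On \<open>E\<close> the form of \<open>H\<close> at \<open>(s, t)\<close> is
  \<open>|f t - s|\<^sup>2 - r\<^sup>2 |t|\<^sup>2 = 2 Re (cnj (e t) w / q) + |w / q|\<^sup>2\<close>.
  An approximant \<open>s / t\<close> with smaller error makes all these values negative, so positive
  semi-definiteness of a weighted sum implies optimality.

  Conversely, let \<open>p / q\<close> be optimal. As \<open>w\<close> ranges over all polynomials of degree at most \<open>d - 2\<close>,
  its values at the \<open>d\<close> points of \<open>E\<close> are subject to the single relation \<open>\<Sum>w / \<nu> = 0\<close> with
  \<open>\<nu>(x) = \<Prod>(x - y)\<close>. First-order optimality therefore determines the weights: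
  \<open>\<omega> cnj (e q) w / q = a\<close> with \<open>a = c w / \<nu>\<close> for a constant \<open>c\<close>.
  Second-order optimality says that the weighted form \<open>B\<close> is nonnegative where \<open>a\<close> is purely imaginary,
  which is impossible for positive defect. For defect zero, every \<open>(s, t)\<close> is the sum of a vector with
  real \<open>a\<close> and one with imaginary \<open>a\<close>. These are \<open>B\<close>-orthogonal, because the bilinear form
  \<open>\<Sum>t\<^sub>1 a\<^sub>2 / q\<close> is symmetric: \<open>t\<^sub>1 w\<^sub>2 - t\<^sub>2 w\<^sub>1 = q (s\<^sub>1 t\<^sub>2 - s\<^sub>2 t\<^sub>1)\<close> and \<open>s\<^sub>1 t\<^sub>2 - s\<^sub>2 t\<^sub>1\<close> has
  degree at most \<open>d - 2\<close>. Hence \<open>B\<close> is nonnegative everywhere.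
\<close>

section \<open>Interpolation on the zeros of a nodal polynomial\<close>

definition node_poly :: "'a::field set \<Rightarrow> 'a \<Rightarrow> 'a poly" where
  "node_poly E x = (\<Prod>y\<in>E - {x}. [:- y, 1:])"

text \<open>For \<open>x\<close> in \<open>E\<close> this is the derivative at \<open>x\<close> of
  the monic polynomial with simple zeros exactly on \<open>E\<close>, hence the denominator in
  divided differences over \<open>E\<close>.\<close>

definition nodal :: "'a::field set \<Rightarrow> 'a \<Rightarrow> 'a" where
  "nodal E x = (\<Prod>y\<in>E - {x}. x - y)"

lemma nodal_nonzero: "finite E \<Longrightarrow> nodal E x \<noteq> 0"
  by (simp add: nodal_def prod_zero_iff)

lemma poly_node_poly:
  assumes "finite E" "x \<in> E"
  shows "poly (node_poly E y) x = (if x = y then nodal E x else 0)"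
  using assms by (auto simp: node_poly_def nodal_def poly_prod prod_zero_iff)

lemma lead_coeff_node_poly:
  assumes "finite E" "x \<in> E"
  shows "degree (node_poly E x) = card E - 1" "coeff (node_poly E x) (card E - 1) = 1"
proof -
  have d: "degree (node_poly E x) = (\<Sum>y\<in>E-{x}. degree [:- y, 1:])"
    unfolding node_poly_def by (rule degree_prod_eq_sum_degree) auto
  then show "degree (node_poly E x) = card E - 1"
    using assms by simp
  then have "coeff (node_poly E x) (card E - 1) = lead_coeff (node_poly E x)"
    by simp
  also have "\<dots> = 1"
    unfolding node_poly_def by (subst lead_coeff_prod) simp
  finally show "coeff (node_poly E x) (card E - 1) = 1" .
qed

lemma poly_eq_on_imp_eq:
  fixes g h :: "'a::field poly"
  assumes "finite E" "degree g < card E" "degree h < card E" "\<And>x. x \<in> E \<Longrightarrow> poly g x = poly h x"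
  shows "g = h"
proof (rule ccontr)
  assume "g \<noteq> h"
  then have nz: "g - h \<noteq> 0" by simp
  have "E \<subseteq> {x. poly (g - h) x = 0}" using assms(4) by auto
  then have "card E \<le> card {x. poly (g - h) x = 0}"
    using poly_roots_finite[OF nz] by (intro card_mono)
  also have "\<dots> \<le> degree (g - h)" by (rule card_poly_roots_bound[OF nz])
  also have "\<dots> < card E" using assms(2,3) by (meson degree_diff_less)
  finally show False by simp
qed

text \<open>Both sides are the divided difference of \<open>g\<close> over \<open>E\<close>:
  Lagrange interpolation expands \<open>g\<close> in the monic polynomials
  \<open>node_poly E x\<close>, and the coefficients of degree \<open>card E - 1\<close> are
  compared.\<close>

lemma sum_over_nodal:
  fixes g :: "'a::field poly"
  assumes "finite E" "degree g < card E"
  shows "(\<Sum>x\<in>E. poly g x / nodal E x) = coeff g (card E - 1)"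
proof -
  let ?h = "\<Sum>x\<in>E. Polynomial.smult (poly g x / nodal E x) (node_poly E x)"
  have "degree ?h \<le> card E - 1"
  proof (intro degree_sum_le[OF assms(1)])
    fix x assume "x \<in> E"
    then show "degree (Polynomial.smult (poly g x / nodal E x) (node_poly E x)) \<le> card E - 1"
      using lead_coeff_node_poly(1)[OF assms(1)] degree_smult_le by metis
  qed
  then have "degree ?h < card E" using assms(2) by linarith
  moreover have "poly g x = poly ?h x" if "x \<in> E" for x
    using that assms(1) nodal_nonzero[OF assms(1)]
    by (simp add: poly_sum poly_node_poly if_distrib cong: if_cong)
  ultimately have "g = ?h" using assms by (intro poly_eq_on_imp_eq[of E])
  then have "coeff g (card E - 1) = coeff ?h (card E - 1)" by simp
  also have "\<dots> = (\<Sum>x\<in>E. poly g x / nodal E x)"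
    using lead_coeff_node_poly(2)[OF assms(1)] by (simp add: coeff_sum)
  finally show ?thesis by simp
qed

lemma sum_over_nodal_eq_0:
  fixes g :: "'a::field poly"
  assumes "finite E" "degree g + 1 < card E"
  shows "(\<Sum>x\<in>E. poly g x / nodal E x) = 0"
proof -
  have "(\<Sum>x\<in>E. poly g x / nodal E x) = coeff g (card E - 1)"
    using assms by (intro sum_over_nodal) simp_all
  also have "\<dots> = 0" using assms(2) by (intro coeff_eq_0) simp
  finally show ?thesis .
qed

text \<open>Converse of \<open>sum_over_nodal_eq_0\<close>: the Lagrange interpolant has the sum of
  the \<open>b x\<close> as coefficient of degree \<open>card E - 1\<close>, so the hypothesis
  lowers its degree by one.\<close>

lemma interpolate_nodal:
  fixes b :: "'a::field \<Rightarrow> 'a"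
  assumes "finite E" "card E \<ge> 2" "(\<Sum>x\<in>E. b x) = 0"
  obtains w where "degree w \<le> card E - 2" "\<And>x. x \<in> E \<Longrightarrow> poly w x = b x * nodal E x"
proof
  let ?w = "\<Sum>x\<in>E. Polynomial.smult (b x) (node_poly E x)"
  have "degree ?w \<le> card E - 1"
  proof (intro degree_sum_le[OF assms(1)])
    fix x assume "x \<in> E"
    then show "degree (Polynomial.smult (b x) (node_poly E x)) \<le> card E - 1"
      using lead_coeff_node_poly(1)[OF assms(1)] degree_smult_le by metis
  qed
  moreover have "coeff ?w (card E - 1) = 0"
    using lead_coeff_node_poly(2)[OF assms(1)] assms(3) by (simp add: coeff_sum)
  ultimately show "degree ?w \<le> card E - 2"
  proof (intro degree_le allI impI)
    fix i assume deg: "degree ?w \<le> card E - 1" and z: "coeff ?w (card E - 1) = 0" and "card E - 2 < i"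
    then consider "i = card E - 1" | "card E - 1 < i" by linarith
    then show "coeff ?w i = 0"
    proof cases
      case 1
      then show ?thesis using z by simp
    next
      case 2
      then show ?thesis using deg by (intro coeff_eq_0) linarith
    qed
  qed
  show "poly ?w x = b x * nodal E x" if "x \<in> E" for x
    using that assms(1) by (simp add: poly_sum poly_node_poly if_distrib cong: if_cong)
qed

section \<open>Bezout identities with degree bounds\<close>

text \<open>A Bezout cofactor is reduced modulo \<open>q\<close>, which bounds
  \<open>degree t\<close>; the bound on \<open>s\<close> is then forced by
  \<open>q * s = p * t - w\<close>.\<close>

lemma bezout_mod:
  fixes p q w :: "'a::field_gcd poly"
  assumes "coprime p q" "q \<noteq> 0" "degree w \<le> n + degree q" "degree p \<le> n"
  obtains s t where "p * t - q * s = w" "degree s \<le> n" "degree t \<le> degree q"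
proof -
  obtain a b where ab: "a * p + b * q = 1"
    using bezout_coefficients_fst_snd[of p q] assms(1) by (metis coprime_iff_gcd_eq_1)
  define t where "t = (w * a) mod q"
  define s where "s = - (w * b) - p * ((w * a) div q)"
  have wa: "w * a = (w * a) div q * q + t" unfolding t_def by simp
  have "p * t = p * (w * a) - p * ((w * a) div q) * q"
    by (subst wa) (simp add: algebra_simps)
  also have "p * (w * a) = w * (a * p)" by (simp add: algebra_simps)
  also have "a * p = 1 - b * q" using ab by (simp add: algebra_simps)
  finally have eq: "p * t - q * s = w" by (simp add: s_def algebra_simps)
  have t: "t = 0 \<or> degree t < degree q"
    unfolding t_def using degree_mod_less[OF assms(2)] by blast
  have "degree (p * t) \<le> n + degree q"
    using t assms(4) by (auto intro: order_trans[OF degree_mult_le] add_mono)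
  moreover have "q * s = p * t - w" using eq by (simp add: algebra_simps)
  ultimately have "degree (q * s) \<le> n + degree q"
    using assms(3) by (metis degree_diff_le)
  then have "degree s \<le> n"
    using assms(2) by (cases "s = 0") (auto simp: degree_mult_eq)
  with eq t show ?thesis by (intro that[of t s]) auto
qed

text \<open>The reduction is modulo \<open>q\<close> or modulo \<open>p\<close>, according to which
  of them attains the minimum in \<open>defect\<close>; the bound on \<open>degree w\<close> is then
  the one that \<open>bezout_mod\<close> requires.\<close>

lemma bezout_defect:
  assumes "coprime p q" "q \<noteq> 0" "degree p \<le> n1" "degree q \<le> n2"
    and "int (degree w) \<le> int n1 + int n2 - defect n1 n2 p q"
  obtains s t where "s \<in> poly_space n1" "t \<in> poly_space n2" "p * t - q * s = w"
proof (cases "p = 0 \<or> int n2 - int (degree q) \<le> int n1 - int (degree p)")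
  case True
  then have "degree w \<le> n1 + degree q"
    using assms(5) by (auto simp: defect_def min_def split: if_splits)
  from bezout_mod[OF assms(1,2) this assms(3)]
  obtain s t where "p * t - q * s = w" "degree s \<le> n1" "degree t \<le> degree q" .
  with assms(4) show ?thesis
    by (intro that[of s t]) (auto simp: poly_space_def)
next
  case False
  then have "degree w \<le> n2 + degree p" "p \<noteq> 0"
    using assms(5) by (auto simp: defect_def min_def split: if_splits)
  moreover have "coprime q p" using assms(1) by (simp add: coprime_commute)
  ultimately obtain s t where st: "q * t - p * s = w" "degree s \<le> n2" "degree t \<le> degree p"
    using bezout_mod assms(4) by metis
  have "p * (- s) - q * (- t) = w" using st by simp
  with st assms(3) show ?thesis
    by (intro that[of "- t" "- s"]) (auto simp: poly_space_def)
qed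

section \<open>Minimax approximants\<close>

lemma quot_of_Fract:
  fixes s t :: "complex poly"
  assumes "t \<noteq> 0"
  obtains k where "s = fst (quot_of_fract (Fract s t)) * k" "t = snd (quot_of_fract (Fract s t)) * k" "k \<noteq> 0"
proof -
  have "quot_of_fract (Fract s t) = normalize_quot (s, t)"
    using assms by transfer simp
  with normalize_quotE[OF assms, of s] that show ?thesis by metis
qed

lemma rat_eval_Fract:
  assumes "poly t x \<noteq> 0"
  shows "\<not> is_pole_of (Fract s t) x" "rat_eval (Fract s t) x = poly s x / poly t x"
proof -
  have "t \<noteq> 0" using assms by auto
  then obtain k where k: "s = fst (quot_of_fract (Fract s t)) * k" "t = snd (quot_of_fract (Fract s t)) * k"
    using quot_of_Fract by metis
  have "poly s x = poly (fst (quot_of_fract (Fract s t))) x * poly k x"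
    "poly t x = poly (snd (quot_of_fract (Fract s t))) x * poly k x"
    using k by (metis poly_mult)+
  then show "\<not> is_pole_of (Fract s t) x" "rat_eval (Fract s t) x = poly s x / poly t x"
    using assms by (auto simp: is_pole_of_def rat_eval_def)
qed

lemma rat_space_quot:
  assumes "\<xi> \<in> rat_space n1 n2"
  shows "fst (quot_of_fract \<xi>) \<in> poly_space n1" "snd (quot_of_fract \<xi>) \<in> poly_space n2"
proof -
  obtain s t where st: "\<xi> = Fract s t" "degree s \<le> n1" "degree t \<le> n2" "t \<noteq> 0"
    using assms by (auto simp: rat_space_def poly_space_def)
  obtain k where k: "s = fst (quot_of_fract \<xi>) * k" "t = snd (quot_of_fract \<xi>) * k" "k \<noteq> 0"
    using quot_of_Fract[OF st(4)] st(1) by metis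
  have "degree (fst (quot_of_fract \<xi>)) \<le> degree s" 
    using k by (metis degree_mult_right_le)
  moreover have "degree (snd (quot_of_fract \<xi>)) \<le> degree t"
    using k by (metis degree_mult_right_le)
  ultimately show "fst (quot_of_fract \<xi>) \<in> poly_space n1" "snd (quot_of_fract \<xi>) \<in> poly_space n2"
    using st by (auto simp: poly_space_def)
qed

lemma max_norm_ge: "finite X \<Longrightarrow> x \<in> X \<Longrightarrow> cmod (g x) \<le> max_norm X g"
  by (auto simp: max_norm_def)

lemma max_norm_less:
  assumes "finite X" "X \<noteq> {}" "\<And>x. x \<in> X \<Longrightarrow> cmod (g x) < r"
  shows "max_norm X g < r"
  using assms by (auto simp: max_norm_def)

text \<open>Clearing denominators lets \<open>(s, t)\<close> range over a linear space. At a zero of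
  \<open>t\<close> the inequality is trivial, so poles and \<open>t = 0\<close> cause no
  exceptions.\<close>

lemma global_minimax_iff:
  assumes "finite X" "X \<noteq> {}" "p \<in> poly_space n1" "q \<in> poly_space n2" "q \<noteq> 0"
    and q: "\<forall>x\<in>X. poly q x \<noteq> 0"
  shows "global_minimax n1 n2 X f (Fract p q) \<longleftrightarrow>
    (\<forall>s\<in>poly_space n1. \<forall>t\<in>poly_space n2.
       \<exists>x\<in>X. cmod (f x * poly t x - poly s x) \<ge> max_norm X (residual f (Fract p q)) * cmod (poly t x))"
    (is "_ \<longleftrightarrow> ?R")
proof -
  let ?r = "max_norm X (residual f (Fract p q))"
  have err: "approx_error X f (Fract p q) = ereal ?r"
    using q rat_eval_Fract(1) by (auto simp: approx_error_def)
  have mem: "Fract p q \<in> rat_space n1 n2" using assms by (auto simp: rat_space_def)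
  have gm: "global_minimax n1 n2 X f (Fract p q) \<longleftrightarrow> (\<forall>\<eta>\<in>rat_space n1 n2. ereal ?r \<le> approx_error X f \<eta>)"
  proof
    assume "global_minimax n1 n2 X f (Fract p q)"
    then show "\<forall>\<eta>\<in>rat_space n1 n2. ereal ?r \<le> approx_error X f \<eta>"
      by (auto simp: global_minimax_def err intro: INF_lower)
  next
    assume "\<forall>\<eta>\<in>rat_space n1 n2. ereal ?r \<le> approx_error X f \<eta>"
    then have "ereal ?r \<le> (INF \<eta>\<in>rat_space n1 n2. approx_error X f \<eta>)"
      by (intro INF_greatest) blast
    moreover have "(INF \<eta>\<in>rat_space n1 n2. approx_error X f \<eta>) \<le> ereal ?r"
      using INF_lower[OF mem, of "approx_error X f"] err by simp
    ultimately show "global_minimax n1 n2 X f (Fract p q)"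
      by (simp add: global_minimax_def err)
  qed
  show ?thesis
  proof
    assume g: "global_minimax n1 n2 X f (Fract p q)"
    show ?R
    proof (intro ballI, rule ccontr)
      fix s t assume st: "s \<in> poly_space n1" "t \<in> poly_space n2"
      assume "\<not> (\<exists>x\<in>X. cmod (f x * poly t x - poly s x) \<ge> ?r * cmod (poly t x))"
      then have less: "cmod (f x * poly t x - poly s x) < ?r * cmod (poly t x)" if "x \<in> X" for x
        using that by force
      have t: "poly t x \<noteq> 0" if "x \<in> X" for x
        using less[OF that] by auto
      then have "t \<noteq> 0" using assms(2) by auto
      with st have mem': "Fract s t \<in> rat_space n1 n2" by (auto simp: rat_space_def)
      have "max_norm X (residual f (Fract s t)) < ?r"
      proof (rule max_norm_less[OF assms(1,2)])
        fix x assume x: "x \<in> X"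
        have "residual f (Fract s t) x = (f x * poly t x - poly s x) / poly t x"
          using t[OF x] by (simp add: residual_def rat_eval_Fract field_simps)
        then show "cmod (residual f (Fract s t) x) < ?r"
          using less[OF x] t[OF x] by (simp add: norm_divide divide_less_eq)
      qed
      moreover have "approx_error X f (Fract s t) = ereal (max_norm X (residual f (Fract s t)))"
        using t rat_eval_Fract(1) by (auto simp: approx_error_def)
      ultimately show False using g gm mem' by (metis ereal_less_eq(3) linorder_not_le)
    qed
  next
    assume R: ?R
    show "global_minimax n1 n2 X f (Fract p q)"
      unfolding gm
    proof
      fix \<eta> assume eta: "\<eta> \<in> rat_space n1 n2"
      show "ereal ?r \<le> approx_error X f \<eta>"
      proof (cases "\<exists>x\<in>X. is_pole_of \<eta> x")
        case False
        let ?s = "fst (quot_of_fract \<eta>)" and ?t = "snd (quot_of_fract \<eta>)"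
        obtain x where x: "x \<in> X" "cmod (f x * poly ?t x - poly ?s x) \<ge> ?r * cmod (poly ?t x)"
          using R rat_space_quot[OF eta] by blast
        have t: "poly ?t x \<noteq> 0" using False x(1) by (auto simp: is_pole_of_def)
        have "residual f \<eta> x = (f x * poly ?t x - poly ?s x) / poly ?t x"
          using t by (simp add: residual_def rat_eval_def field_simps)
        then have "?r \<le> cmod (residual f \<eta> x)"
          using x(2) t by (simp add: norm_divide le_divide_eq)
        also have "\<dots> \<le> max_norm X (residual f \<eta>)" by (rule max_norm_ge[OF assms(1) x(1)])
        finally show ?thesis using False by (simp add: approx_error_def)
      qed (simp add: approx_error_def)
    qed
  qed
qed

section \<open>First- and second-order optimality conditions\<close>

lemma Re_of_real_mult: "Re (of_real a * z) = a * Re z"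
  by simp

lemma cmod_add_power2: "(cmod (a + b))\<^sup>2 = (cmod a)\<^sup>2 + 2 * Re (cnj a * b) + (cmod b)\<^sup>2"
  unfolding cmod_power2 by (simp add: power2_eq_square algebra_simps)

text \<open>Setting of the necessity direction, with optimality in the denominator-free form of
  \<open>global_minimax_iff\<close>.\<close>

locale minimax_extremal =
  fixes n1 n2 :: nat and X E :: "complex set" and f :: "complex \<Rightarrow> complex" and p q :: "complex poly" and r :: real
  assumes finite_X: "finite X"
    and p_space: "degree p \<le> n1" and q_space: "degree q \<le> n2" and q_nonzero: "q \<noteq> 0"
    and coprime: "coprime p q"
    and q_on_X: "x \<in> X \<Longrightarrow> poly q x \<noteq> 0"
    and r_pos: "r > 0"
    and E_subset: "E \<subseteq> X"
    and card_E: "int (card E) = int n1 + int n2 - defect n1 n2 p q + 2"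
    and error_E: "x \<in> E \<Longrightarrow> cmod (f x - poly p x / poly q x) = r"
    and error_less: "x \<in> X - E \<Longrightarrow> cmod (f x - poly p x / poly q x) < r"
    and minimax: "s \<in> poly_space n1 \<Longrightarrow> t \<in> poly_space n2 \<Longrightarrow>
      \<exists>x\<in>X. cmod (f x * poly t x - poly s x) \<ge> r * cmod (poly t x)"
begin

definition err :: "complex \<Rightarrow> complex" where
  "err x = f x - poly p x / poly q x"

text \<open>Minus the numerator of the derivative of
  \<open>(p + \<epsilon> s) / (q + \<epsilon> t)\<close> at \<open>\<epsilon> = 0\<close>.\<close>

definition lin :: "complex poly \<Rightarrow> complex poly \<Rightarrow> complex poly" where
  "lin s t = p * t - q * s"

definition gap :: "complex poly \<Rightarrow> complex poly \<Rightarrow> complex \<Rightarrow> real" where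
  "gap s t x = (cmod (f x * poly t x - poly s x))\<^sup>2 - r\<^sup>2 * (cmod (poly t x))\<^sup>2"

lemma finite_E: "finite E"
  using finite_X E_subset finite_subset by blast

lemma q_on_E: "x \<in> E \<Longrightarrow> poly q x \<noteq> 0"
  using q_on_X E_subset by blast

lemma defect_le: "defect n1 n2 p q \<le> int n2"
  by (auto simp: defect_def)

lemma card_E_ge: "card E \<ge> 2"
  using card_E defect_le by linarith

lemma err_nonzero: "x \<in> E \<Longrightarrow> err x \<noteq> 0"
  using error_E[of x] r_pos by (auto simp: err_def)

text \<open>
  On \<open>E\<close> the residual splits as \<open>f t - s = err t + lin s t / q\<close>, and \<open>|err| = r\<close> cancels the leading terms.
\<close>

lemma gap_E:
  assumes "x \<in> E"
  shows "gap s t x = 2 * Re (cnj (err x * poly t x) * poly (lin s t) x / poly q x)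
                      + (cmod (poly (lin s t) x / poly q x))\<^sup>2"
proof -
  let ?w = "poly (lin s t) x / poly q x"
  have "f x * poly t x - poly s x = err x * poly t x + ?w"
    using q_on_E[OF assms] by (simp add: err_def lin_def field_simps)
  moreover have "(cmod (err x * poly t x + ?w))\<^sup>2 =
      (cmod (err x * poly t x))\<^sup>2 + 2 * Re (cnj (err x * poly t x) * ?w) + (cmod ?w)\<^sup>2"
    by (rule cmod_add_power2)
  moreover have "(cmod (err x * poly t x))\<^sup>2 = r\<^sup>2 * (cmod (poly t x))\<^sup>2"
    using error_E[OF assms] by (simp add: err_def norm_mult power_mult_distrib)
  ultimately show ?thesis
    unfolding gap_def times_divide_eq_right[symmetric] by simp
qed

text \<open>The number of extreme points makes two bounds meet: interpolation yields degree at most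
  \<open>card E - 2\<close>, which is what \<open>bezout_defect\<close> admits.\<close>

lemma solve_lin:
  assumes "(\<Sum>x\<in>E. b x) = 0"
  obtains s t where "s \<in> poly_space n1" "t \<in> poly_space n2"
    "\<And>x. x \<in> E \<Longrightarrow> poly (lin s t) x = b x * nodal E x"
proof -
  obtain w where w: "degree w \<le> card E - 2" "\<And>x. x \<in> E \<Longrightarrow> poly w x = b x * nodal E x"
    using interpolate_nodal[OF finite_E card_E_ge assms] by blast
  then have "int (degree w) \<le> int n1 + int n2 - defect n1 n2 p q"
    using card_E card_E_ge by linarith
  from bezout_defect[OF coprime q_nonzero p_space q_space this]
  obtain s t where "s \<in> poly_space n1" "t \<in> poly_space n2" "p * t - q * s = w" .
  with w(2) show ?thesis by (intro that[of s t]) (simp_all add: lin_def)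
qed

text \<open>
  Otherwise \<open>(p + \<epsilon> s1 + \<epsilon>\<^sup>2 s2) / (q + \<epsilon> t1 + \<epsilon>\<^sup>2 t2)\<close> would have a smaller error for small \<open>\<epsilon> > 0\<close>.
\<close>

lemma perturbation_not_descending:
  assumes st: "s1 \<in> poly_space n1" "t1 \<in> poly_space n2" "s2 \<in> poly_space n1" "t2 \<in> poly_space n2"
  defines "D \<equiv> \<lambda>s t x. Re (cnj (err x * poly q x) * poly (lin s t) x / poly q x)"
  shows "\<exists>x\<in>E. D s1 t1 x > 0 \<or> D s1 t1 x = 0 \<and> gap s1 t1 x + 2 * D s2 t2 x \<ge> 0"
proof (rule ccontr)
  assume "\<not> ?thesis"
  then have desc: "D s1 t1 x < 0 \<or> D s1 t1 x = 0 \<and> gap s1 t1 x + 2 * D s2 t2 x < 0" if "x \<in> E" for x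
    using that by force
  let ?cr = complex_of_real
  define S where "S = (\<lambda>\<epsilon>. p + Polynomial.smult (?cr \<epsilon>) s1 + Polynomial.smult (?cr (\<epsilon>\<^sup>2)) s2)"
  define T where "T = (\<lambda>\<epsilon>. q + Polynomial.smult (?cr \<epsilon>) t1 + Polynomial.smult (?cr (\<epsilon>\<^sup>2)) t2)"
  have ST: "S \<epsilon> \<in> poly_space n1" "T \<epsilon> \<in> poly_space n2" for \<epsilon>
    using st p_space q_space
    by (auto simp: S_def T_def poly_space_def intro!: degree_add_le order_trans[OF degree_smult_le])
  have ev: "\<forall>\<^sub>F \<epsilon> in at_right 0. cmod (f x * poly (T \<epsilon>) x - poly (S \<epsilon>) x) < r * cmod (poly (T \<epsilon>) x)"
    if x: "x \<in> X" for x
  proof (cases "x \<in> E")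
    case False
    \<comment> \<open>Off \<open>E\<close> the inequality is already strict at
      \<open>\<epsilon> = 0\<close>, and continuity preserves it.\<close>
    let ?h = "\<lambda>\<epsilon>. r * cmod (poly (T \<epsilon>) x) - cmod (f x * poly (T \<epsilon>) x - poly (S \<epsilon>) x)"
    have q0: "poly q x \<noteq> 0" using q_on_X x by simp
    have "f x * poly q x - poly p x = (f x - poly p x / poly q x) * poly q x"
      using q0 by (simp add: field_simps)
    then have "cmod (f x * poly q x - poly p x) < r * cmod (poly q x)"
      using error_less[of x] False x q0 by (simp add: norm_mult)
    then have h0: "?h 0 > 0" by (simp add: S_def T_def)
    have "isCont ?h 0"
      unfolding S_def T_def poly_add poly_smult by (intro continuous_intros)
    then have "(?h \<longlongrightarrow> ?h 0) (at_right 0)"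
      by (simp add: isCont_def filterlim_at_split)
    then have "\<forall>\<^sub>F \<epsilon> in at_right 0. ?h \<epsilon> > 0"
      using h0 by (rule order_tendstoD(1))
    then show ?thesis by eventually_elim simp
  next
    case True
    let ?q = "poly q x"
    define w1 w2 where "w1 = poly (lin s1 t1) x" and "w2 = poly (lin s2 t2) x"
    define A where "A = D s1 t1 x"
    define G where "G = (\<lambda>\<epsilon>. 2 * Re (cnj (err x) * (cnj ?q * w2 + (cnj (poly t1 x) + ?cr \<epsilon> * cnj (poly t2 x)) * (w1 + ?cr \<epsilon> * w2)) / ?q)
       + (cmod ((w1 + ?cr \<epsilon> * w2) / ?q))\<^sup>2)"
    have q0: "?q \<noteq> 0" using q_on_E True by simp
    \<comment> \<open>Since \<open>lin p q = 0\<close>, a factor \<open>\<epsilon>\<close> splits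
      off.\<close>
    have lin: "poly (lin (S \<epsilon>) (T \<epsilon>)) x = ?cr \<epsilon> * (w1 + ?cr \<epsilon> * w2)" for \<epsilon>
      by (simp add: lin_def S_def T_def w1_def w2_def algebra_simps power2_eq_square)
    have T: "poly (T \<epsilon>) x = ?q + ?cr \<epsilon> * poly t1 x + ?cr (\<epsilon>\<^sup>2) * poly t2 x" for \<epsilon>
      by (simp add: T_def)
    have gap: "gap (S \<epsilon>) (T \<epsilon>) x = \<epsilon> * (2 * A + \<epsilon> * G \<epsilon>)" for \<epsilon>
    proof -
      have "cnj (err x * poly (T \<epsilon>) x) * poly (lin (S \<epsilon>) (T \<epsilon>)) x / ?q =
        ?cr \<epsilon> * (cnj (err x * ?q) * w1 / ?q) + ?cr (\<epsilon>\<^sup>2) * (cnj (err x) * (cnj ?q * w2 + (cnj (poly t1 x) + ?cr \<epsilon> * cnj (poly t2 x)) * (w1 + ?cr \<epsilon> * w2)) / ?q)"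
        unfolding lin T using q0 by (simp add: field_simps power2_eq_square)
      moreover have "(cmod (poly (lin (S \<epsilon>) (T \<epsilon>)) x / ?q))\<^sup>2 = \<epsilon>\<^sup>2 * (cmod ((w1 + ?cr \<epsilon> * w2) / ?q))\<^sup>2"
        unfolding lin by (simp add: norm_mult norm_divide power_mult_distrib power_divide)
      ultimately show ?thesis
        unfolding gap_E[OF True] A_def D_def G_def w1_def[symmetric]
        by (simp only: plus_complex.sel Re_of_real_mult) (simp add: algebra_simps power2_eq_square)
    qed
    have G_cont: "isCont G 0" unfolding G_def using q0 by (intro continuous_intros) auto
    \<comment> \<open>The second-order coefficient combines the form at the first direction with the
      first-order effect of the correction.\<close>
    have G0: "G 0 = gap s1 t1 x + 2 * D s2 t2 x"
      unfolding gap_E[OF True] G_def D_def w1_def[symmetric] w2_def[symmetric]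
      by (simp add: algebra_simps add_divide_distrib)
    have "\<forall>\<^sub>F \<epsilon> in at_right 0. gap (S \<epsilon>) (T \<epsilon>) x < 0"
    \<comment> \<open>The sign for small \<open>\<epsilon>\<close> is decided by \<open>A\<close> if
      it is negative, and by \<open>G 0\<close> if it vanishes.\<close>
    proof (cases "A < 0")
      case True
      have "isCont (\<lambda>\<epsilon>. 2 * A + \<epsilon> * G \<epsilon>) 0" using G_cont by (intro continuous_intros)
      then have "((\<lambda>\<epsilon>. 2 * A + \<epsilon> * G \<epsilon>) \<longlongrightarrow> 2 * A) (at_right 0)"
        by (simp add: isCont_def filterlim_at_split)
      then have "\<forall>\<^sub>F \<epsilon> in at_right 0. 2 * A + \<epsilon> * G \<epsilon> < 0"
        using True by (intro order_tendstoD(2)[where y = "2 * A"]) auto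
      moreover have "\<forall>\<^sub>F \<epsilon> in at_right 0. \<epsilon> > (0::real)" by (rule eventually_at_right_less)
      ultimately show ?thesis by eventually_elim (simp add: gap mult_pos_neg)
    next
      case False
      then have A0: "A = 0" "G 0 < 0" using desc[OF \<open>x \<in> E\<close>] by (auto simp: A_def G0)
      have "(G \<longlongrightarrow> G 0) (at_right 0)"
        using G_cont by (simp add: isCont_def filterlim_at_split)
      then have "\<forall>\<^sub>F \<epsilon> in at_right 0. G \<epsilon> < 0" using A0(2) by (rule order_tendstoD(2))
      moreover have "\<forall>\<^sub>F \<epsilon> in at_right 0. \<epsilon> > (0::real)" by (rule eventually_at_right_less)
      ultimately show ?thesis by eventually_elim (simp add: gap A0(1) mult_pos_neg)
    qed
    then show ?thesis
    proof eventually_elim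
      fix \<epsilon> assume "gap (S \<epsilon>) (T \<epsilon>) x < 0"
      then have "(cmod (f x * poly (T \<epsilon>) x - poly (S \<epsilon>) x))\<^sup>2 < (r * cmod (poly (T \<epsilon>) x))\<^sup>2"
        by (simp add: gap_def power_mult_distrib)
      then show "cmod (f x * poly (T \<epsilon>) x - poly (S \<epsilon>) x) < r * cmod (poly (T \<epsilon>) x)"
        by (rule power2_less_imp_less) (use r_pos in simp)
    qed
  qed
  have "\<forall>\<^sub>F \<epsilon> in at_right 0. \<forall>x\<in>X. cmod (f x * poly (T \<epsilon>) x - poly (S \<epsilon>) x) < r * cmod (poly (T \<epsilon>) x)"
    using ev finite_X by (simp add: eventually_ball_finite)
  then obtain \<epsilon> where "\<forall>x\<in>X. cmod (f x * poly (T \<epsilon>) x - poly (S \<epsilon>) x) < r * cmod (poly (T \<epsilon>) x)"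
    using eventually_happens[of _ "at_right (0::real)"] by (auto simp: trivial_limit_at_right_real)
  with minimax[OF ST] show False by (meson linorder_not_le)
qed

section \<open>First-order condition and the weights\<close>

definition slope :: "complex \<Rightarrow> complex" where
  "slope x = cnj (err x * poly q x) * nodal E x / poly q x"

lemma slope_nonzero: "x \<in> E \<Longrightarrow> slope x \<noteq> 0"
  using err_nonzero q_on_E nodal_nonzero[OF finite_E] by (simp add: slope_def)

text \<open>By \<open>solve_lin\<close> every \<open>b\<close> with sum zero gives an admissible
  direction, and \<open>slope\<close> is the factor that turns \<open>b\<close> into its first-order
  effect. No second-order correction is applied.\<close>

lemma first_order:
  assumes "(\<Sum>x\<in>E. b x) = 0"
  shows "\<exists>x\<in>E. Re (slope x * b x) \<ge> 0"
proof -
  obtain s t where st: "s \<in> poly_space n1" "t \<in> poly_space n2"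
    "\<And>x. x \<in> E \<Longrightarrow> poly (lin s t) x = b x * nodal E x"
    using solve_lin[OF assms] by blast
  have "0 \<in> poly_space n1" "0 \<in> poly_space n2" by (simp_all add: poly_space_def)
  from perturbation_not_descending[OF st(1,2) this]
  obtain x where x: "x \<in> E" "Re (cnj (err x * poly q x) * poly (lin s t) x / poly q x) \<ge> 0"
    by force
  moreover have "cnj (err x * poly q x) * poly (lin s t) x / poly q x = slope x * b x"
    using st(3)[OF x(1)] by (simp add: slope_def)
  ultimately show ?thesis by metis
qed

text \<open>
  The half planes \<open>Re (slope x * b) < 0\<close> and \<open>Re (slope y * b) < 0\<close> have all of the plane as their sum
  unless they coincide, and then the condition \<open>\<Sum>b = 0\<close> would not obstruct a descent direction.
\<close>

lemma sgn_slope_eq: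
  assumes x: "x \<in> E" and y: "y \<in> E"
  shows "sgn (slope x) = sgn (slope y)"
proof (rule ccontr)
  let ?u = "sgn (slope x)" and ?v = "sgn (slope y)"
  assume neq: "?u \<noteq> ?v"
  then have "x \<noteq> y" by auto
  have polar: "slope x = of_real (cmod (slope x)) * ?u" "slope y = of_real (cmod (slope y)) * ?v"
    using slope_nonzero x y by (simp_all add: sgn_eq)
  have u: "(cmod ?u)\<^sup>2 = 1" "(cmod ?v)\<^sup>2 = 1"
    using slope_nonzero x y by (simp_all add: norm_sgn)
  define \<kappa> where "\<kappa> = 1 - Re (?u * cnj ?v)"
  have "(cmod (?u - ?v))\<^sup>2 = 2 * \<kappa>"
    using u unfolding \<kappa>_def cmod_power2 by (simp add: power2_eq_square algebra_simps)
  moreover have "cmod (?u - ?v) > 0" using neq by simp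
  ultimately have \<kappa>: "\<kappa> > 0" by (metis zero_less_mult_iff zero_less_numeral zero_less_power not_less_iff_gr_or_eq)
  \<comment> \<open>Moving along \<open>\<eta>\<close> descends at \<open>x\<close>, moving along
    \<open>- \<eta>\<close> descends at \<open>y\<close>, because the unit directions
    differ.\<close>
  define \<eta> where "\<eta> = cnj (?v - ?u)"
  have eta: "Re (slope x * \<eta>) = - (cmod (slope x) * \<kappa>)" "Re (slope y * \<eta>) = cmod (slope y) * \<kappa>"
  proof -
    have "Re (?u * \<eta>) = - \<kappa>" "Re (?v * \<eta>) = \<kappa>"
      using u unfolding \<eta>_def \<kappa>_def cmod_power2 by (simp_all add: power2_eq_square algebra_simps)
    then show "Re (slope x * \<eta>) = - (cmod (slope x) * \<kappa>)" "Re (slope y * \<eta>) = cmod (slope y) * \<kappa>"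
      by (subst polar(1) polar(2), simp add: mult.assoc)+
  qed
  define S where "S = (\<Sum>z\<in>E - {x, y}. cnj (slope z))"
  have "cmod (slope y) * \<kappa> > 0" using \<kappa> slope_nonzero[OF y] by simp
  then obtain M where M: "M * (cmod (slope y) * \<kappa>) = \<bar>Re (slope y * S)\<bar> + 1" "M > 0"
    by (intro that[of "(\<bar>Re (slope y * S)\<bar> + 1) / (cmod (slope y) * \<kappa>)"])
      (auto simp del: times_complex.sel intro!: divide_pos_pos)
  \<comment> \<open>All other points get a descending value. Their total \<open>- S\<close> is
    balanced at \<open>y\<close>, and \<open>M\<close> is so large that the term \<open>S\<close>
    does not spoil the descent there.\<close>
  define b where "b = (\<lambda>z. if z = x then of_real M * \<eta> else if z = y then S - of_real M * \<eta> else - cnj (slope z))"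
  have E: "E = insert x (insert y (E - {x, y}))" using x y by auto
  have "(\<Sum>z\<in>E. b z) = b x + (b y + (\<Sum>z\<in>E - {x, y}. b z))"
    using finite_E \<open>x \<noteq> y\<close> by (subst E) simp
  also have "(\<Sum>z\<in>E - {x, y}. b z) = - S"
    unfolding S_def sum_negf[symmetric] by (intro sum.cong) (auto simp: b_def)
  finally have "(\<Sum>z\<in>E. b z) = 0" using \<open>x \<noteq> y\<close> by (simp add: b_def)
  from first_order[OF this] obtain z where z: "z \<in> E" "Re (slope z * b z) \<ge> 0" by blast
  consider "z = x" | "z = y" | "z \<noteq> x" "z \<noteq> y" by blast
  then show False
  proof cases
    case 1
    then have "Re (slope z * b z) = M * Re (slope x * \<eta>)"
      by (simp add: b_def algebra_simps)
    also have "\<dots> < 0" using M(2) \<kappa> slope_nonzero[OF x] unfolding eta by (simp add: mult_pos_neg)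
    finally show False using z by simp
  next
    case 2
    then have "Re (slope z * b z) = Re (slope y * S) - M * Re (slope y * \<eta>)"
      using \<open>x \<noteq> y\<close> by (simp add: b_def algebra_simps)
    also have "\<dots> < 0" unfolding eta M(1) by linarith
    finally show False using z by simp
  next
    case 3
    then have "Re (slope z * b z) = - (cmod (slope z))\<^sup>2"
      unfolding b_def cmod_power2 by (simp add: power2_eq_square)
    then show False using z slope_nonzero[OF z(1)] by simp
  qed
qed

text \<open>As all slopes share one direction, weights inversely proportional to their moduli make
  the products equal; \<open>\<Sigma>\<close> normalises the total.\<close>

lemma obtain_weights:
  obtains \<omega> c where "\<And>x. x \<in> E \<Longrightarrow> \<omega> x > (0::real)" "(\<Sum>x\<in>E. \<omega> x) = 1" "c \<noteq> 0"
    "\<And>x. x \<in> E \<Longrightarrow> of_real (\<omega> x) * slope x = c"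
proof -
  have ne: "E \<noteq> {}" using card_E_ge by auto
  then obtain y where y: "y \<in> E" by blast
  define \<Sigma> where "\<Sigma> = (\<Sum>x\<in>E. inverse (cmod (slope x)))"
  have \<Sigma>: "\<Sigma> > 0" unfolding \<Sigma>_def using slope_nonzero ne finite_E by (intro sum_pos) auto
  show ?thesis
  proof
    show "inverse (cmod (slope x)) / \<Sigma> > 0" if "x \<in> E" for x
      using slope_nonzero[OF that] \<Sigma> by simp
    show "(\<Sum>x\<in>E. inverse (cmod (slope x)) / \<Sigma>) = 1"
      unfolding sum_divide_distrib[symmetric] \<Sigma>_def[symmetric] using \<Sigma> by simp
    show "sgn (slope y) / of_real \<Sigma> \<noteq> 0" using slope_nonzero[OF y] \<Sigma> by (simp add: sgn_zero_iff)
    show "of_real (inverse (cmod (slope x)) / \<Sigma>) * slope x = sgn (slope y) / of_real \<Sigma>" if "x \<in> E" for x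
      using sgn_slope_eq[OF that y, symmetric]
      by (simp add: sgn_div_norm scaleR_conv_of_real)
  qed
qed

end

section \<open>Second-order condition for the weighted form\<close>

locale critical_weights = minimax_extremal +
  fixes \<omega> :: "complex \<Rightarrow> real" and c :: complex
  assumes weight_pos: "x \<in> E \<Longrightarrow> \<omega> x > 0" and c_nonzero: "c \<noteq> 0"
    and weight_slope: "x \<in> E \<Longrightarrow> of_real (\<omega> x) * slope x = c"
begin

text \<open>The quantity \<open>a\<close> of the overview; \<open>weight_lin\<close> identifies it
  on \<open>E\<close> with the weighted first-order term.\<close>

definition dual :: "complex poly \<Rightarrow> complex poly \<Rightarrow> complex \<Rightarrow> complex" where
  "dual s t x = c * poly (lin s t) x / nodal E x"

text \<open>The form \<open>B\<close> of the overview, that is, the quadratic form of the weighted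
  matrix sum at \<open>(s, t)\<close>.\<close>

definition lagr :: "complex poly \<Rightarrow> complex poly \<Rightarrow> real" where
  "lagr s t = (\<Sum>x\<in>E. \<omega> x * gap s t x)"

lemma nodal_E: "nodal E x \<noteq> 0"
  by (rule nodal_nonzero[OF finite_E])

lemma weight_lin:
  assumes "x \<in> E"
  shows "of_real (\<omega> x) * (cnj (err x * poly q x) * poly (lin s t) x / poly q x) = dual s t x"
proof -
  have "of_real (\<omega> x) * (cnj (err x * poly q x) * poly (lin s t) x / poly q x)
      = (of_real (\<omega> x) * slope x) * poly (lin s t) x / nodal E x"
    using nodal_E by (simp add: slope_def)
  then show ?thesis unfolding weight_slope[OF assms] dual_def by simp
qed

lemma weight_gap:
  assumes "x \<in> E"
  shows "\<omega> x * gap s t x = 2 * Re (cnj (poly t x / poly q x) * dual s t x) + \<omega> x * (cmod (poly (lin s t) x / poly q x))\<^sup>2"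
proof -
  have "cnj (poly t x / poly q x) * dual s t x = of_real (\<omega> x) * (cnj (err x * poly t x) * poly (lin s t) x / poly q x)"
    unfolding weight_lin[OF assms, symmetric] using q_on_E[OF assms] by simp
  then have "Re (cnj (poly t x / poly q x) * dual s t x) = \<omega> x * Re (cnj (err x * poly t x) * poly (lin s t) x / poly q x)"
    by (simp only: Re_of_real_mult)
  then show ?thesis unfolding gap_E[OF assms] by (simp add: algebra_simps)
qed

lemma solve_dual:
  assumes "(\<Sum>x\<in>E. a x) = 0"
  obtains s t where "s \<in> poly_space n1" "t \<in> poly_space n2" "\<And>x. x \<in> E \<Longrightarrow> dual s t x = a x"
proof -
  have "(\<Sum>x\<in>E. a x / c) = 0" using assms by (simp add: sum_divide_distrib[symmetric])
  from solve_lin[OF this] obtain s t where "s \<in> poly_space n1" "t \<in> poly_space n2"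
    "\<And>x. x \<in> E \<Longrightarrow> poly (lin s t) x = a x / c * nodal E x" by blast
  with nodal_E c_nonzero show ?thesis by (intro that[of s t]) (auto simp: dual_def)
qed

text \<open>
  If \<open>lagr s t < 0\<close>, a second-order correction \<open>(s2, t2)\<close> distributes this value evenly over \<open>E\<close>.
\<close>

lemma second_order:
  assumes st: "s \<in> poly_space n1" "t \<in> poly_space n2" and im: "\<And>x. x \<in> E \<Longrightarrow> Re (dual s t x) = 0"
  shows "lagr s t \<ge> 0"
proof (rule ccontr)
  assume neg: "\<not> lagr s t \<ge> 0"
  have card: "card E > 0" using card_E_ge by simp
  define a where "a = (\<lambda>x. (lagr s t / card E - \<omega> x * gap s t x) / 2)"
  have "(\<Sum>x\<in>E. a x) = 0"
    using card by (simp add: a_def sum_subtractf sum_divide_distrib[symmetric] lagr_def)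
  then have "(\<Sum>x\<in>E. complex_of_real (a x)) = 0" by (metis of_real_0 of_real_sum)
  from solve_dual[OF this] obtain s2 t2 where st2: "s2 \<in> poly_space n1" "t2 \<in> poly_space n2"
    "\<And>x. x \<in> E \<Longrightarrow> dual s2 t2 x = complex_of_real (a x)" by blast
  let ?D = "\<lambda>s t x. Re (cnj (err x * poly q x) * poly (lin s t) x / poly q x)"
  have D: "\<omega> x * ?D s' t' x = Re (dual s' t' x)" if "x \<in> E" for x s' t'
    using weight_lin[OF that, of s' t'] by (metis Re_of_real_mult)
  obtain x where x: "x \<in> E" "?D s t x > 0 \<or> ?D s t x = 0 \<and> gap s t x + 2 * ?D s2 t2 x \<ge> 0"
    using perturbation_not_descending[OF st st2(1,2)] by blast
  note pos = weight_pos[OF x(1)]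
  have "?D s t x = 0" using D[OF x(1), of s t] im[OF x(1)] pos by simp
  then have "\<omega> x * (gap s t x + 2 * ?D s2 t2 x) \<ge> 0" using x(2) pos by simp
  then have "\<omega> x * gap s t x + 2 * a x \<ge> 0"
    using D[OF x(1), of s2 t2] st2(3)[OF x(1)] by (simp add: algebra_simps)
  moreover have "2 * a x = lagr s t / card E - \<omega> x * gap s t x" by (simp add: a_def)
  ultimately have "lagr s t / card E \<ge> 0" by linarith
  then show False using neg card by (simp add: zero_le_divide_iff)
qed

text \<open>
  With a positive defect, \<open>(p h, q h)\<close> may be added for linear \<open>h\<close>; this does not change \<^term>\<open>lin\<close>
  but changes \<^term>\<open>lagr\<close> by an arbitrary real amount.
\<close>

lemma defect_zero: "defect n1 n2 p q = 0"
proof (rule ccontr)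
  assume nz: "defect n1 n2 p q \<noteq> 0"
  have "defect n1 n2 p q \<ge> 0" using p_space q_space by (auto simp: defect_def)
  with nz have "defect n1 n2 p q \<ge> 1" by simp
  then have deg: "p = 0 \<or> degree p < n1" "degree q < n2"
    by (auto simp: defect_def split: if_splits)
  obtain x y where xy: "x \<in> E" "y \<in> E" "x \<noteq> y"
    using card_E_ge by (metis card_le_Suc0_iff_eq finite_E not_less_eq_eq numeral_2_eq_2)
  \<comment> \<open>Imaginary values with sum zero, so that \<open>second_order\<close> applies to
    the solution; two opposite ones detect the difference \<open>h x - h y\<close>.\<close>
  define a where "a = (\<lambda>z. if z = x then \<i> else if z = y then - \<i> else 0)"
  have E: "E = insert x (insert y (E - {x, y}))" using xy by auto
  have sum_a: "(\<Sum>z\<in>E. g z * a z) = \<i> * (g x - g y)" for g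
  proof -
    have "(\<Sum>z\<in>E. g z * a z) = g x * a x + (g y * a y + (\<Sum>z\<in>E - {x, y}. g z * a z))"
      using finite_E xy(3) by (subst E) simp
    also have "(\<Sum>z\<in>E - {x, y}. g z * a z) = 0" by (intro sum.neutral) (auto simp: a_def)
    finally show ?thesis using xy(3) by (simp add: a_def algebra_simps)
  qed
  have "(\<Sum>z\<in>E. a z) = 0" using sum_a[of "\<lambda>_. 1"] by simp
  from solve_dual[OF this] obtain s t where st: "s \<in> poly_space n1" "t \<in> poly_space n2"
    "\<And>z. z \<in> E \<Longrightarrow> dual s t z = a z" by blast
  \<comment> \<open>With this \<open>M\<close> and \<open>h\<close> the cross term is
    \<open>- 2 * (\<bar>lagr s t\<bar> + 1)\<close>, which makes the new value of
    \<open>lagr\<close> negative.\<close>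
  define M where "M = (\<bar>lagr s t\<bar> + 1) / (cmod (x - y))\<^sup>2"
  define h where "h = [:0, - \<i> * of_real M * cnj (x - y):]"
  let ?s = "s + p * h" and ?t = "t + q * h"
  have "degree h \<le> 1" by (simp add: h_def)
  then have "degree (p * h) \<le> n1" "degree (q * h) \<le> n2"
    using deg degree_mult_le[of p h] degree_mult_le[of q h] by (cases "p = 0"; simp)+
  then have "?s \<in> poly_space n1" "?t \<in> poly_space n2"
    using st(1,2) by (auto simp: poly_space_def intro!: degree_add_le)
  moreover have lin: "lin ?s ?t = lin s t" by (simp add: lin_def algebra_simps)
  then have dual: "dual ?s ?t z = dual s t z" for z by (simp add: dual_def)
  ultimately have "lagr ?s ?t \<ge> 0"
    using st(3) by (intro second_order) (auto simp: a_def)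
  moreover have "lagr ?s ?t = lagr s t + 2 * Re (\<Sum>z\<in>E. cnj (poly h z) * a z)"
  proof -
    have "\<omega> z * gap ?s ?t z = \<omega> z * gap s t z + 2 * Re (cnj (poly h z) * a z)" if "z \<in> E" for z
      unfolding weight_gap[OF that] dual lin st(3)[OF that]
      using q_on_E[OF that] by (simp add: add_divide_distrib algebra_simps)
    then show ?thesis
      by (simp add: lagr_def sum.distrib sum_distrib_left)
  qed
  moreover have "(\<Sum>z\<in>E. cnj (poly h z) * a z) = - of_real (M * (cmod (x - y))\<^sup>2)"
    unfolding sum_a h_def of_real_mult complex_norm_square by (simp add: algebra_simps)
  moreover have "M * (cmod (x - y))\<^sup>2 = \<bar>lagr s t\<bar> + 1"
    using xy(3) by (simp add: M_def)
  ultimately show False by simp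
qed

text \<open>
  \<open>t1 lin s2 t2 - t2 lin s1 t1 = q (s1 t2 - s2 t1)\<close>, and the divided difference of the second factor vanishes.
\<close>

lemma dual_symmetric:
  assumes st: "s1 \<in> poly_space n1" "t1 \<in> poly_space n2" "s2 \<in> poly_space n1" "t2 \<in> poly_space n2"
  shows "(\<Sum>x\<in>E. poly t1 x / poly q x * dual s2 t2 x) = (\<Sum>x\<in>E. poly t2 x / poly q x * dual s1 t1 x)"
proof -
  let ?g = "s1 * t2 - s2 * t1"
  have card: "card E = n1 + n2 + 2" using card_E defect_zero by simp
  have "degree ?g \<le> n1 + n2"
    using st by (auto simp: poly_space_def intro!: degree_diff_le order_trans[OF degree_mult_le])
  then have "(\<Sum>x\<in>E. poly ?g x / nodal E x) = 0"
    using card by (intro sum_over_nodal_eq_0 finite_E) simp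
  moreover have "poly t1 x / poly q x * dual s2 t2 x - poly t2 x / poly q x * dual s1 t1 x
      = c * (poly ?g x / nodal E x)" if "x \<in> E" for x
    using q_on_E[OF that] nodal_E by (simp add: dual_def lin_def field_simps)
  then have "(\<Sum>x\<in>E. poly t1 x / poly q x * dual s2 t2 x) - (\<Sum>x\<in>E. poly t2 x / poly q x * dual s1 t1 x)
      = c * (\<Sum>x\<in>E. poly ?g x / nodal E x)"
    by (simp add: sum_subtractf[symmetric] sum_distrib_left)
  ultimately show ?thesis by simp
qed

text \<open>With defect zero, every \<open>lin s t\<close> has degree at most
  \<open>card E - 2\<close>, so the relation holds for all pairs and passes to the imaginary parts
  alone.\<close>

lemma sum_dual:
  assumes "s \<in> poly_space n1" "t \<in> poly_space n2"
  shows "(\<Sum>x\<in>E. dual s t x) = 0"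
proof -
  have card: "card E = n1 + n2 + 2" using card_E defect_zero by simp
  have "degree (lin s t) \<le> n1 + n2"
    unfolding lin_def using assms p_space q_space
    by (auto simp: poly_space_def intro!: degree_diff_le order_trans[OF degree_mult_le])
  then have "(\<Sum>x\<in>E. poly (lin s t) x / nodal E x) = 0"
    using card by (intro sum_over_nodal_eq_0 finite_E) simp
  moreover have "(\<Sum>x\<in>E. dual s t x) = c * (\<Sum>x\<in>E. poly (lin s t) x / nodal E x)"
    by (simp add: dual_def sum_distrib_left)
  ultimately show ?thesis by simp
qed

lemma lagr_nonneg:
  assumes st: "s \<in> poly_space n1" "t \<in> poly_space n2"
  shows "lagr s t \<ge> 0"
proof -
  have "(\<Sum>x\<in>E. \<i> * of_real (Im (dual s t x))) = \<i> * of_real (Im (\<Sum>x\<in>E. dual s t x))"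
    by (simp add: sum_distrib_left)
  then have "(\<Sum>x\<in>E. \<i> * of_real (Im (dual s t x))) = 0"
    by (simp add: sum_dual[OF st])
  from solve_dual[OF this] obtain s2 t2 where st2: "s2 \<in> poly_space n1" "t2 \<in> poly_space n2"
    "\<And>x. x \<in> E \<Longrightarrow> dual s2 t2 x = \<i> * of_real (Im (dual s t x))" by blast
  define s1 t1 where "s1 = s - s2" and "t1 = t - t2"
  have st1: "s1 \<in> poly_space n1" "t1 \<in> poly_space n2"
    using st st2 by (auto simp: s1_def t1_def poly_space_def intro: degree_diff_le)
  have lin1: "poly (lin s1 t1) x = poly (lin s t) x - poly (lin s2 t2) x" for x
    by (simp add: s1_def t1_def lin_def algebra_simps)
  have dual1: "dual s1 t1 x = of_real (Re (dual s t x))" if "x \<in> E" for x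
  proof -
    have "dual s1 t1 x = dual s t x - dual s2 t2 x"
      using nodal_E by (simp add: dual_def lin1 algebra_simps diff_divide_distrib)
    then show ?thesis using st2(3)[OF that] by (simp add: complex_eq_iff)
  qed
  have B2: "lagr s2 t2 \<ge> 0" using st2 by (intro second_order) auto
  \<comment> \<open>Multiplication by \<open>\<i>\<close> turns the real \<open>dual\<close> values
    into imaginary ones without changing \<open>gap\<close>, so \<open>second_order\<close> covers
    this part too.\<close>
  let ?is = "Polynomial.smult \<i> s1" and ?it = "Polynomial.smult \<i> t1"
  have "dual ?is ?it x = \<i> * dual s1 t1 x" for x
    by (simp add: dual_def lin_def algebra_simps diff_divide_distrib)
  moreover have "?is \<in> poly_space n1" "?it \<in> poly_space n2" using st1 by (simp_all add: poly_space_def)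
  ultimately have "lagr ?is ?it \<ge> 0" using dual1 by (intro second_order) auto
  moreover have "gap ?is ?it x = gap s1 t1 x" for x
  proof -
    have "f x * poly ?it x - poly ?is x = \<i> * (f x * poly t1 x - poly s1 x)" by (simp add: algebra_simps)
    then show ?thesis by (simp add: gap_def norm_mult)
  qed
  ultimately have B1: "lagr s1 t1 \<ge> 0" by (simp add: lagr_def)
  let ?\<tau> = "\<lambda>t x. poly t x / poly q x"
  have cross: "\<omega> x * gap s t x = \<omega> x * gap s1 t1 x + \<omega> x * gap s2 t2 x
      + 2 * Re (?\<tau> t2 x * dual s1 t1 x - ?\<tau> t1 x * dual s2 t2 x)" if x: "x \<in> E" for x
  proof -
    let ?a = "Re (dual s t x)" and ?b = "Im (dual s t x)" and ?n = "nodal E x / (c * poly q x)"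
    have w: "poly (lin s' t') x / poly q x = ?n * dual s' t' x" for s' t'
      using nodal_E c_nonzero by (simp add: dual_def)
    have t: "?\<tau> t x = ?\<tau> t1 x + ?\<tau> t2 x" by (simp add: t1_def diff_divide_distrib)
    have d: "dual s t x = of_real ?a + \<i> * of_real ?b" by (simp add: complex_eq_iff)
    \<comment> \<open>The real and imaginary parts contribute no mixed term to the squared
      modulus.\<close>
    have "(cmod (n * z))\<^sup>2 = (cmod (n * of_real (Re z)))\<^sup>2 + (cmod (n * (\<i> * of_real (Im z))))\<^sup>2" for n z
      by (simp add: norm_mult power_mult_distrib cmod_power2[of z] algebra_simps)
    from this[of ?n "dual s t x"] have sq: "(cmod (?n * dual s t x))\<^sup>2 = (cmod (?n * dual s1 t1 x))\<^sup>2 + (cmod (?n * dual s2 t2 x))\<^sup>2"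
      unfolding dual1[OF x] st2(3)[OF x] .
    have re: "Re (cnj (?\<tau> t1 x + ?\<tau> t2 x) * dual s t x) =
       Re (cnj (?\<tau> t1 x) * dual s1 t1 x) + Re (cnj (?\<tau> t2 x) * dual s2 t2 x)
       + Re (?\<tau> t2 x * dual s1 t1 x - ?\<tau> t1 x * dual s2 t2 x)"
    proof -
      \<comment> \<open>Inside \<open>Re\<close>, the conjugation in a mixed term moves to the other
        factor: it fixes \<open>a\<close> and negates \<open>\<i> * b\<close>. The mixed terms thus
        become a difference of bilinear ones, which \<open>dual_symmetric\<close> cancels after
        summation.\<close>
      have "Re (cnj (u + v) * (of_real a + \<i> * of_real b)) =
          Re (cnj u * of_real a) + Re (cnj v * (\<i> * of_real b)) + Re (v * of_real a - u * (\<i> * of_real b))"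
        for u v a b by (simp add: algebra_simps)
      from this[of "?\<tau> t1 x" "?\<tau> t2 x" ?a ?b] show ?thesis
        unfolding dual1[OF x] st2(3)[OF x] d[symmetric] .
    qed
    show ?thesis
      unfolding weight_gap[OF x] w sq t re by (simp add: algebra_simps)
  qed
  have "lagr s t = lagr s1 t1 + lagr s2 t2
     + 2 * Re ((\<Sum>x\<in>E. ?\<tau> t2 x * dual s1 t1 x) - (\<Sum>x\<in>E. ?\<tau> t1 x * dual s2 t2 x))"
    unfolding lagr_def by (simp only: sum_subtractf[symmetric] Re_sum sum_distrib_left sum.distrib[symmetric])
      (intro sum.cong refl cross)
  also have "\<dots> = lagr s1 t1 + lagr s2 t2"
    using dual_symmetric[OF st1 st2(1,2)] by simp
  finally show ?thesis using B1 B2 by simp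
qed

end

section \<open>The quadratic form of the weighted matrix\<close>

lemma mat_adjoint_index:
  assumes "i < dim_col A" "j < dim_row A"
  shows "mat_adjoint A $$ (i, j) = conjugate (A $$ (j, i))"
  using assms by (simp add: mat_adjoint_def mat_of_rows_def)

lemma mat_adjoint_carrier: "A \<in> carrier_mat m n \<Longrightarrow> mat_adjoint A \<in> carrier_mat n m"
  by (auto simp: mat_adjoint_def)

text \<open>Carrier and entries are proved together, since the induction step for the entries needs
  the dimensions of the partial sum.\<close>

lemma weighted_mat_sum_index:
  assumes "finite J" "\<And>j. j \<in> J \<Longrightarrow> A j \<in> carrier_mat N N"
  shows "weighted_mat_sum N J \<omega> A \<in> carrier_mat N N \<and>
    (\<forall>l<N. \<forall>k<N. weighted_mat_sum N J \<omega> A $$ (l, k) = (\<Sum>j\<in>J. of_real (\<omega> j) * A j $$ (l, k)))"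
proof -
  interpret M: abelian_group "module_mat TYPE(complex) N N" by (rule abelian_group_mat)
  show ?thesis
    using assms
  proof (induction J rule: finite_induct)
    case empty
    then show ?case by (simp add: weighted_mat_sum_def module_mat_simps)
  next
    case (insert j J)
    let ?B = "of_real (\<omega> j) \<cdot>\<^sub>m A j"
    have carr: "?B \<in> carrier_mat N N" using insert.prems by simp
    have IH: "weighted_mat_sum N J \<omega> A \<in> carrier_mat N N"
      "\<And>l k. l < N \<Longrightarrow> k < N \<Longrightarrow> weighted_mat_sum N J \<omega> A $$ (l, k) = (\<Sum>j\<in>J. of_real (\<omega> j) * A j $$ (l, k))"
      using insert by auto
    have "weighted_mat_sum N (insert j J) \<omega> A = ?B + weighted_mat_sum N J \<omega> A"
      unfolding weighted_mat_sum_def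
      using insert.hyps insert.prems by (subst M.finsum_insert) (auto simp: module_mat_simps)
    moreover have "?B $$ (l, k) = of_real (\<omega> j) * A j $$ (l, k)" if "l < N" "k < N" for l k
      using insert.prems[of j] that by auto
    ultimately show ?case
      using IH carr insert.hyps by auto
  qed
qed

lemma sum_lessThan_add:
  "(\<Sum>k<a + b. g k) = (\<Sum>k<a. g k) + (\<Sum>k<b. g (a + k))" for g :: "nat \<Rightarrow> 'a::comm_monoid_add"
  by (induction b) (simp_all add: add.assoc)

text \<open>The library span has coefficients indexed by the basis polynomials; injectivity of
  \<open>\<psi>\<close> transfers them to indices.\<close>

lemma poly_space_basis_iff:
  assumes "poly_space_basis k \<psi>"
  shows "s \<in> poly_space k \<longleftrightarrow> (\<exists>c. s = (\<Sum>i<Suc k. Polynomial.smult (c i) (\<psi> i)))"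
proof -
  interpret Modules.module "Polynomial.smult :: complex \<Rightarrow> complex poly \<Rightarrow> complex poly"
    by unfold_locales (simp_all add: smult_add_right smult_add_left)
  have inj: "inj_on \<psi> {0..k}" and sp: "span (\<psi> ` {0..k}) = poly_space k"
    using assms by (simp_all add: poly_space_basis_def)
  have eq: "(\<Sum>v\<in>\<psi> ` {0..k}. Polynomial.smult (u v) v) = (\<Sum>i<Suc k. Polynomial.smult (u (\<psi> i)) (\<psi> i))" for u
    by (subst sum.reindex[OF inj]) (simp add: atLeast0AtMost lessThan_Suc_atMost)
  have "poly_space k = range (\<lambda>u. \<Sum>i<Suc k. Polynomial.smult (u (\<psi> i)) (\<psi> i))"
    unfolding sp[symmetric] by (subst span_finite) (simp_all only: eq finite_imageI finite_atLeastAtMost)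
  moreover have "(\<Sum>i<Suc k. Polynomial.smult (c i) (\<psi> i)) =
      (\<Sum>i<Suc k. Polynomial.smult (c (inv_into {0..k} \<psi> (\<psi> i))) (\<psi> i))" for c
    using inv_into_f_f[OF inj] by (intro sum.cong) auto
  ultimately show ?thesis
    by (auto simp: image_iff) (metis comp_apply)+
qed

text \<open>On a coordinate vector of \<open>(s, t)\<close> this row gives the value of
  \<open>f t - s\<close> at \<open>x\<close>, and \<open>denominator_row\<close> gives that of
  \<open>t\<close>. They exhibit \<open>H(x)\<close> as a difference of two rank-one
  matrices.\<close>

definition residual_row ::
  "nat \<Rightarrow> (nat \<Rightarrow> complex poly) \<Rightarrow> (nat \<Rightarrow> complex poly) \<Rightarrow> (complex \<Rightarrow> complex) \<Rightarrow> complex \<Rightarrow> nat \<Rightarrow> complex"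
  where "residual_row n1 \<psi> \<phi> f x k =
    (if k < n1 + 1 then - poly (\<psi> k) x else f x * poly (\<phi> (k - (n1 + 1))) x)"

definition denominator_row :: "nat \<Rightarrow> (nat \<Rightarrow> complex poly) \<Rightarrow> complex \<Rightarrow> nat \<Rightarrow> complex"
  where "denominator_row n1 \<phi> x k = (if k < n1 + 1 then 0 else poly (\<phi> (k - (n1 + 1))) x)"

lemma H_mat_eq:
  "H_mat n1 n2 \<psi> \<phi> f r x = mat (n1 + n2 + 2) (n1 + n2 + 2)
    (\<lambda>(l, k). cnj (residual_row n1 \<psi> \<phi> f x l) * residual_row n1 \<psi> \<phi> f x k
      - of_real (r\<^sup>2) * cnj (denominator_row n1 \<phi> x l) * denominator_row n1 \<phi> x k)" (is "_ = ?M")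
proof (rule eq_matI)
  fix l k assume "l < dim_row ?M" "k < dim_col ?M"
  then have lk: "l < n1 + n2 + 2" "k < n1 + n2 + 2" by simp_all
  have H2: "complex_of_real ((cmod (f x))\<^sup>2 - r\<^sup>2) = cnj (f x) * f x - of_real (r\<^sup>2)"
    unfolding of_real_diff complex_norm_square by (simp add: mult.commute)
  show "H_mat n1 n2 \<psi> \<phi> f r x $$ (l, k) = ?M $$ (l, k)"
    using lk unfolding H_mat_def H2_mat_def H2
    by (auto simp: H1_mat_def H3_mat_def mat_adjoint_index residual_row_def denominator_row_def algebra_simps)
qed (simp_all add: H_mat_def H1_mat_def H2_mat_def)

lemma rank_one_form:
  fixes g v :: "nat \<Rightarrow> complex"
  shows "(\<Sum>l<N. (\<Sum>k<N. cnj (g l) * g k * v k) * cnj (v l)) = of_real ((cmod (\<Sum>k<N. g k * v k))\<^sup>2)"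
proof -
  have "(\<Sum>l<N. (\<Sum>k<N. cnj (g l) * g k * v k) * cnj (v l)) = (\<Sum>l<N. cnj (g l * v l) * (\<Sum>k<N. g k * v k))"
    by (simp add: sum_distrib_left sum_distrib_right algebra_simps)
  also have "\<dots> = cnj (\<Sum>l<N. g l * v l) * (\<Sum>k<N. g k * v k)"
    by (simp add: sum_distrib_right)
  also have "\<dots> = of_real ((cmod (\<Sum>k<N. g k * v k))\<^sup>2)"
    unfolding complex_norm_square by (rule mult.commute)
  finally show ?thesis .
qed

lemma hermitian_psd_iff:
  assumes basis: "poly_space_basis n1 \<psi>" "poly_space_basis n2 \<phi>" and fin: "finite J"
  shows "hermitian_psd (n1 + n2 + 2) (weighted_mat_sum (n1 + n2 + 2) J \<omega> (\<lambda>j. H_mat n1 n2 \<psi> \<phi> f r (z j)))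
    \<longleftrightarrow> (\<forall>s\<in>poly_space n1. \<forall>t\<in>poly_space n2. 0 \<le>
      (\<Sum>j\<in>J. \<omega> j * ((cmod (f (z j) * poly t (z j) - poly s (z j)))\<^sup>2 - r\<^sup>2 * (cmod (poly t (z j)))\<^sup>2)))"
proof -
  define N where "N = n1 + n2 + 2"
  define g where "g = residual_row n1 \<psi> \<phi> f"
  define h where "h = denominator_row n1 \<phi>"
  define A where "A = weighted_mat_sum N J \<omega> (\<lambda>j. H_mat n1 n2 \<psi> \<phi> f r (z j))"
  \<comment> \<open>The first \<open>Suc n1\<close> entries of a vector are the coordinates of the
    numerator, the remaining ones those of the denominator.\<close>
  define S where "S = (\<lambda>v. \<Sum>i<Suc n1. Polynomial.smult (v i) (\<psi> i))"
  define T where "T = (\<lambda>v. \<Sum>i<Suc n2. Polynomial.smult (v (Suc n1 + i)) (\<phi> i))"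
  let ?form = "\<lambda>s t. \<Sum>j\<in>J. \<omega> j * ((cmod (f (z j) * poly t (z j) - poly s (z j)))\<^sup>2 - r\<^sup>2 * (cmod (poly t (z j)))\<^sup>2)"
  have H: "H_mat n1 n2 \<psi> \<phi> f r x = mat N N (\<lambda>(l, k). cnj (g x l) * g x k - of_real (r\<^sup>2) * cnj (h x l) * h x k)" for x
    unfolding N_def g_def h_def by (rule H_mat_eq)
  have A: "A \<in> carrier_mat N N"
    "\<And>l k. l < N \<Longrightarrow> k < N \<Longrightarrow> A $$ (l, k) =
      (\<Sum>j\<in>J. of_real (\<omega> j) * (cnj (g (z j) l) * g (z j) k - of_real (r\<^sup>2) * cnj (h (z j) l) * h (z j) k))"
    using weighted_mat_sum_index[OF fin, of "\<lambda>j. H_mat n1 n2 \<psi> \<phi> f r (z j)" N \<omega>]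
    by (auto simp: A_def H)
  have herm: "mat_adjoint A = A"
  proof (rule eq_matI)
    show "dim_row (mat_adjoint A) = dim_row A" "dim_col (mat_adjoint A) = dim_col A"
      using A(1) mat_adjoint_carrier[OF A(1)] by auto
    fix l k assume "l < dim_row A" "k < dim_col A"
    then show "mat_adjoint A $$ (l, k) = A $$ (l, k)"
      using A(1) by (subst mat_adjoint_index) (auto simp: A(2) mult_ac intro!: sum.cong)
  qed
  have gS: "(\<Sum>k<N. g x k * v k) = f x * poly (T v) x - poly (S v) x" for x v
  proof -
    have "N = Suc n1 + Suc n2" by (simp add: N_def)
    then have "(\<Sum>k<N. g x k * v k) = (\<Sum>k<Suc n1. g x k * v k) + (\<Sum>k<Suc n2. g x (Suc n1 + k) * v (Suc n1 + k))"
      by (simp only: sum_lessThan_add)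
    also have "(\<Sum>k<Suc n1. g x k * v k) = - poly (S v) x"
      unfolding S_def poly_sum sum_negf[symmetric] by (intro sum.cong) (auto simp: g_def residual_row_def)
    also have "(\<Sum>k<Suc n2. g x (Suc n1 + k) * v (Suc n1 + k)) = f x * poly (T v) x"
      unfolding T_def poly_sum sum_distrib_left by (intro sum.cong) (auto simp: g_def residual_row_def)
    finally show ?thesis by simp
  qed
  have hT: "(\<Sum>k<N. h x k * v k) = poly (T v) x" for x v
  proof -
    have "N = Suc n1 + Suc n2" by (simp add: N_def)
    then have "(\<Sum>k<N. h x k * v k) = (\<Sum>k<Suc n1. h x k * v k) + (\<Sum>k<Suc n2. h x (Suc n1 + k) * v (Suc n1 + k))"
      by (simp only: sum_lessThan_add)
    also have "(\<Sum>k<Suc n1. h x k * v k) = 0"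
      by (intro sum.neutral) (auto simp: h_def denominator_row_def)
    also have "(\<Sum>k<Suc n2. h x (Suc n1 + k) * v (Suc n1 + k)) = poly (T v) x"
      unfolding T_def poly_sum by (intro sum.cong) (auto simp: h_def denominator_row_def)
    finally show ?thesis by simp
  qed
  have form: "Re ((A *\<^sub>v v) \<bullet>c v) = ?form (S (vec_index v)) (T (vec_index v))" if v: "v \<in> carrier_vec N" for v
  proof -
    let ?v = "vec_index v"
    have "(A *\<^sub>v v) \<bullet>c v = (\<Sum>l<N. (\<Sum>k<N. A $$ (l, k) * ?v k) * cnj (?v l))"
      using v A(1) by (auto simp: scalar_prod_def atLeast0LessThan row_def intro!: sum.cong)
    also have "\<dots> = (\<Sum>l<N. (\<Sum>k<N. (\<Sum>j\<in>J. of_real (\<omega> j) *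
         (cnj (g (z j) l) * g (z j) k - of_real (r\<^sup>2) * cnj (h (z j) l) * h (z j) k)) * ?v k) * cnj (?v l))"
      by (intro sum.cong refl) (simp add: A(2))
    also have "\<dots> = (\<Sum>l<N. \<Sum>k<N. \<Sum>j\<in>J. of_real (\<omega> j) *
         (cnj (g (z j) l) * g (z j) k - of_real (r\<^sup>2) * cnj (h (z j) l) * h (z j) k) * ?v k * cnj (?v l))"
      by (simp only: sum_distrib_right)
    also have "\<dots> = (\<Sum>j\<in>J. \<Sum>l<N. \<Sum>k<N. of_real (\<omega> j) *
         (cnj (g (z j) l) * g (z j) k - of_real (r\<^sup>2) * cnj (h (z j) l) * h (z j) k) * ?v k * cnj (?v l))"
      by (subst sum.swap[of _ _ J]) (intro sum.cong refl sum.swap)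
    also have "\<dots> = (\<Sum>j\<in>J. of_real (\<omega> j) * ((\<Sum>l<N. (\<Sum>k<N. cnj (g (z j) l) * g (z j) k * ?v k) * cnj (?v l))
         - of_real (r\<^sup>2) * (\<Sum>l<N. (\<Sum>k<N. cnj (h (z j) l) * h (z j) k * ?v k) * cnj (?v l))))"
      by (intro sum.cong refl)
        (simp add: sum_distrib_left sum_distrib_right sum_subtractf[symmetric] algebra_simps)
    also have "\<dots> = of_real (?form (S ?v) (T ?v))"
      unfolding rank_one_form gS hT by simp
    finally show ?thesis by simp
  qed
  have "hermitian_psd N A \<longleftrightarrow> (\<forall>v\<in>carrier_vec N. 0 \<le> ?form (S (vec_index v)) (T (vec_index v)))"
    using A(1) herm form by (simp add: hermitian_psd_def)
  also have "\<dots> \<longleftrightarrow> (\<forall>s\<in>poly_space n1. \<forall>t\<in>poly_space n2. 0 \<le> ?form s t)"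
  proof
    assume *: "\<forall>v\<in>carrier_vec N. 0 \<le> ?form (S (vec_index v)) (T (vec_index v))"
    show "\<forall>s\<in>poly_space n1. \<forall>t\<in>poly_space n2. 0 \<le> ?form s t"
    proof (intro ballI)
      fix s t assume "s \<in> poly_space n1" "t \<in> poly_space n2"
      then obtain c d where cd: "s = (\<Sum>i<Suc n1. Polynomial.smult (c i) (\<psi> i))"
        "t = (\<Sum>i<Suc n2. Polynomial.smult (d i) (\<phi> i))"
        using poly_space_basis_iff basis by metis
      define v where "v = vec N (\<lambda>k. if k < Suc n1 then c k else d (k - Suc n1))"
      have st: "S (vec_index v) = s" "T (vec_index v) = t"
        unfolding S_def T_def cd by (auto simp: v_def N_def intro!: sum.cong)
      have "v \<in> carrier_vec N" by (simp add: v_def)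
      from bspec[OF * this] show "0 \<le> ?form s t" unfolding st .
    qed
  next
    assume *: "\<forall>s\<in>poly_space n1. \<forall>t\<in>poly_space n2. 0 \<le> ?form s t"
    have "S v \<in> poly_space n1" "T v \<in> poly_space n2" for v
      unfolding S_def T_def poly_space_basis_iff[OF basis(1)] poly_space_basis_iff[OF basis(2)]
      by (rule exI, rule refl)+
    then show "\<forall>v\<in>carrier_vec N. 0 \<le> ?form (S (vec_index v)) (T (vec_index v))"
      using * by blast
  qed
  finally show ?thesis by (simp add: A_def N_def)
qed

theorem theorem3p2:
  fixes n1 n2 d :: nat
    and X :: "complex set"
    and f :: "complex \<Rightarrow> complex"
    and p q :: "complex poly"
    and z :: "nat \<Rightarrow> complex"
    and \<psi> \<phi> :: "nat \<Rightarrow> complex poly"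
  assumes "finite X"
    and "card X \<ge> n1 + n2 + 2"
    and "\<not> (\<exists>\<xi>\<in>rat_space n1 n2. agrees_on X f \<xi>)"
    and "p \<in> poly_space n1" and "q \<in> poly_space n2" and "q \<noteq> 0"
    and "coprime p q"
    and "\<forall>x\<in>X. poly q x \<noteq> 0"
    and "int d = int n1 + int n2 - defect n1 n2 p q + 2"
    and "bij_betw z {1..d} (extreme_points X f (Fract p q))"
    and "poly_space_basis n1 \<psi>" and "poly_space_basis n2 \<phi>"
  shows "global_minimax n1 n2 X f (Fract p q) \<longleftrightarrow>
    (\<exists>\<omega> :: nat \<Rightarrow> real.
       (\<forall>j\<in>{1..d}. \<omega> j > 0) \<and> (\<Sum>j=1..d. \<omega> j) = 1 \<and>
       hermitian_psd (n1 + n2 + 2)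
         (weighted_mat_sum (n1 + n2 + 2) {1..d} \<omega>
            (\<lambda>j. H_mat n1 n2 \<psi> \<phi> f (max_norm X (residual f (Fract p q))) (z j))))"
proof -
  define r where "r = max_norm X (residual f (Fract p q))"
  define E where "E = extreme_points X f (Fract p q)"
  have ne: "X \<noteq> {}" using assms(2) by auto
  have E: "E \<subseteq> X" by (auto simp: E_def extreme_points_def)
  have bij: "bij_betw z {1..d} E" using assms(10) by (simp add: E_def)
  then have card: "card E = d" using bij_betw_same_card by fastforce
  have res: "residual f (Fract p q) x = f x - poly p x / poly q x" if "x \<in> X" for x
    using that assms(8) by (simp add: residual_def rat_eval_Fract)
  have gm: "global_minimax n1 n2 X f (Fract p q) \<longleftrightarrow>
    (\<forall>s\<in>poly_space n1. \<forall>t\<in>poly_space n2. \<exists>x\<in>X. cmod (f x * poly t x - poly s x) \<ge> r * cmod (poly t x))"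
    unfolding r_def by (rule global_minimax_iff[OF assms(1) ne assms(4,5,6,8)])
  have psd: "hermitian_psd (n1 + n2 + 2) (weighted_mat_sum (n1 + n2 + 2) {1..d} \<omega> (\<lambda>j. H_mat n1 n2 \<psi> \<phi> f r (z j)))
    \<longleftrightarrow> (\<forall>s\<in>poly_space n1. \<forall>t\<in>poly_space n2. 0 \<le>
      (\<Sum>j=1..d. \<omega> j * ((cmod (f (z j) * poly t (z j) - poly s (z j)))\<^sup>2 - r\<^sup>2 * (cmod (poly t (z j)))\<^sup>2)))" for \<omega>
    by (rule hermitian_psd_iff[OF assms(11,12)]) simp
  \<comment> \<open>Error zero would make \<open>f\<close> agree with \<open>p / q\<close> on
    \<open>X\<close>.\<close>
  have r_pos: "r > 0"
  proof (rule ccontr)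
    assume "\<not> r > 0"
    then have "cmod (residual f (Fract p q) x) \<le> 0" if "x \<in> X" for x
      using max_norm_ge[OF assms(1) that, of "residual f (Fract p q)"] unfolding r_def by linarith
    then have "agrees_on X f (Fract p q)"
      using assms(8) by (auto simp: agrees_on_def rat_eval_Fract residual_def)
    moreover have "Fract p q \<in> rat_space n1 n2" using assms(4-6) by (auto simp: rat_space_def)
    ultimately show False using assms(3) by blast
  qed
  show ?thesis
    unfolding r_def[symmetric]
  proof
    assume g: "global_minimax n1 n2 X f (Fract p q)"
    interpret minimax_extremal n1 n2 X E f p q r
    proof
      show "cmod (f x - poly p x / poly q x) = r" if "x \<in> E" for x
        using that res[of x] by (auto simp: E_def extreme_points_def r_def)
      show "cmod (f x - poly p x / poly q x) < r" if "x \<in> X - E" for x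
        using that res[of x] max_norm_ge[OF assms(1), of x "residual f (Fract p q)"]
        by (auto simp: E_def extreme_points_def r_def)
      show "int (card E) = int n1 + int n2 - defect n1 n2 p q + 2" using card assms(9) by simp
      show "\<exists>x\<in>X. cmod (f x * poly t x - poly s x) \<ge> r * cmod (poly t x)"
        if "s \<in> poly_space n1" "t \<in> poly_space n2" for s t
        using g gm that by blast
    qed (use assms r_pos E in \<open>auto simp: poly_space_def\<close>)
    obtain \<omega> c where w: "\<And>x. x \<in> E \<Longrightarrow> \<omega> x > (0::real)" "(\<Sum>x\<in>E. \<omega> x) = 1" "c \<noteq> 0"
      "\<And>x. x \<in> E \<Longrightarrow> of_real (\<omega> x) * slope x = c"
      using obtain_weights by blast
    interpret critical_weights n1 n2 X E f p q r \<omega> c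
      by unfold_locales (use w in auto)
    have sum: "(\<Sum>j=1..d. F (z j)) = (\<Sum>x\<in>E. F x)" for F :: "complex \<Rightarrow> real"
      by (rule sum.reindex_bij_betw[OF bij])
    show "\<exists>\<omega>. (\<forall>j\<in>{1..d}. \<omega> j > 0) \<and> (\<Sum>j=1..d. \<omega> j) = 1 \<and>
       hermitian_psd (n1 + n2 + 2)
         (weighted_mat_sum (n1 + n2 + 2) {1..d} \<omega> (\<lambda>j. H_mat n1 n2 \<psi> \<phi> f r (z j)))"
    proof (intro exI[of _ "\<lambda>j. \<omega> (z j)"] conjI)
      show "\<forall>j\<in>{1..d}. \<omega> (z j) > 0" using w(1) bij by (auto simp: bij_betw_def)
      show "(\<Sum>j=1..d. \<omega> (z j)) = 1" using sum[of \<omega>] w(2) by simp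
      show "hermitian_psd (n1 + n2 + 2)
         (weighted_mat_sum (n1 + n2 + 2) {1..d} (\<lambda>j. \<omega> (z j)) (\<lambda>j. H_mat n1 n2 \<psi> \<phi> f r (z j)))"
        unfolding psd
      proof (intro ballI)
        fix s t assume st: "s \<in> poly_space n1" "t \<in> poly_space n2"
        show "0 \<le> (\<Sum>j=1..d. \<omega> (z j) * ((cmod (f (z j) * poly t (z j) - poly s (z j)))\<^sup>2 - r\<^sup>2 * (cmod (poly t (z j)))\<^sup>2))"
          using lagr_nonneg[OF st] sum[of "\<lambda>x. \<omega> x * gap s t x"] by (simp add: lagr_def gap_def)
      qed
    qed
  next
    assume "\<exists>\<omega>. (\<forall>j\<in>{1..d}. \<omega> j > 0) \<and> (\<Sum>j=1..d. \<omega> j) = 1 \<and>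
       hermitian_psd (n1 + n2 + 2)
         (weighted_mat_sum (n1 + n2 + 2) {1..d} \<omega> (\<lambda>j. H_mat n1 n2 \<psi> \<phi> f r (z j)))"
    then obtain \<omega> where w: "\<And>j. j \<in> {1..d} \<Longrightarrow> \<omega> j > (0::real)" "(\<Sum>j=1..d. \<omega> j) = 1"
      and nonneg: "\<And>s t. s \<in> poly_space n1 \<Longrightarrow> t \<in> poly_space n2 \<Longrightarrow> 0 \<le>
      (\<Sum>j=1..d. \<omega> j * ((cmod (f (z j) * poly t (z j) - poly s (z j)))\<^sup>2 - r\<^sup>2 * (cmod (poly t (z j)))\<^sup>2))"
      unfolding psd by blast
    show "global_minimax n1 n2 X f (Fract p q)"
      unfolding gm
    proof (intro ballI, rule ccontr)
      fix s t assume st: "s \<in> poly_space n1" "t \<in> poly_space n2"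
        and "\<not> (\<exists>x\<in>X. cmod (f x * poly t x - poly s x) \<ge> r * cmod (poly t x))"
      then have less: "cmod (f x * poly t x - poly s x) < r * cmod (poly t x)" if "x \<in> X" for x
        using that by force
      have "(\<Sum>j=1..d. \<omega> j * ((cmod (f (z j) * poly t (z j) - poly s (z j)))\<^sup>2 - r\<^sup>2 * (cmod (poly t (z j)))\<^sup>2)) < (\<Sum>j=1..d. 0)"
      proof (rule sum_strict_mono)
        \<comment> \<open>An empty index set is excluded because the weights have sum one.\<close>
        show "{1..d} \<noteq> {}" using w(2) by force
        fix j assume j: "j \<in> {1..d}"
        then have "z j \<in> X" using bij E by (auto simp: bij_betw_def)
        from less[OF this] have "(cmod (f (z j) * poly t (z j) - poly s (z j)))\<^sup>2 < (r * cmod (poly t (z j)))\<^sup>2"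
          by (intro power_strict_mono) auto
        then show "\<omega> j * ((cmod (f (z j) * poly t (z j) - poly s (z j)))\<^sup>2 - r\<^sup>2 * (cmod (poly t (z j)))\<^sup>2) < 0"
          using w(1)[OF j] by (simp add: power_mult_distrib mult_pos_neg)
      qed simp
      with nonneg[OF st] show False by simp
    qed
  qed
qed

end
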